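(* Let $N\ge1$, let $\psi(\cdot,\xi_i):\mathbb{R}^n\to\mathbb{R}$, $i=1,\dots,N$, be differentiable, let $\tilde\phi$ be a smoothing function of $\phi:\mathbb{R}\to\mathbb{R}$, and set $\tilde f(x,\mu)=\frac1N\sum_{i=1}^N\tilde\phi(\psi(x,\xi_i),\mu)$. Let the mini-batch $B$ be sampled uniformly at random from $\{1,2,\dots,N\}$, with each index $i$ equally likely to be selected, without replacement. Then the stochastic batch smoothing gradient $$\tilde g(x,\mu)=\frac1{|B|}\sum_{i\in B}\tilde\phi'(\psi(x,\xi_i),\mu)\nabla_x\psi(x,\xi_i)$$ is an unbiased stochastic estimator of $\nabla_x\tilde f(x,\mu)$, that is, $\nabla_x\tilde f(x,\mu)=\mathbb{E}[\tilde g(x,\mu)]$ for all $x\in\mathbb{R}^n$ and $\mu>0$.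
   Context: The finite-sum compositional objective is $f(x)=\frac1N\sum_{i=1}^N\phi(\psi(x,\xi_i))$, where $\xi_i$ is the $i$-th data sample and $\phi:\mathbb{R}\to\mathbb{R}$ is locally Lipschitz and possibly non-smooth. A smoothing function of $\phi$ is a function $\tilde\phi:\mathbb{R}\times[0,+\infty)\to\mathbb{R}$ such that $\tilde\phi(\cdot,\mu)$ is continuously differentiable for each $\mu>0$ and $\lim_{z\to t,\,\mu\downarrow0}\tilde\phi(z,\mu)=\phi(t)$ for all $t$; $\tilde\phi'(\cdot,\mu)$ is the derivative of $\tilde\phi(\cdot,\mu)$. The batch size $|B|\ge1$ is fixed, and here the expectation is over the random sampling of $B$, with the data $\xi_1,\dots,\xi_N$ fixed. *)

theory Defs
  imports "HOL-Probability.Probability"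
begin

definition locally_lipschitz :: "(real \<Rightarrow> real) \<Rightarrow> bool" where
  "locally_lipschitz \<phi> \<longleftrightarrow>
     (\<forall>t. \<exists>\<epsilon>>0. \<exists>L. L-lipschitz_on (ball t \<epsilon>) \<phi>)"

(* A smoothing function has the parameter domain [0, \<infinity>). It is modelled as a total function
   whose values at negative parameters are never referred to. In the joint limit the first
   argument z ranges over full neighbourhoods of t (z = t is allowed), the parameter over
   strictly positive values. *)
definition smoothing_function :: "(real \<Rightarrow> real \<Rightarrow> real) \<Rightarrow> (real \<Rightarrow> real) \<Rightarrow> bool" where
  "smoothing_function \<Phi> \<phi> \<longleftrightarrow>
     (\<forall>\<mu>>0. (\<lambda>z. \<Phi> z \<mu>) C1_differentiable_on UNIV) \<and>
     (\<forall>t. ((\<lambda>(z, \<mu>). \<Phi> z \<mu>) \<longlongrightarrow> \<phi> t) (nhds t \<times>\<^sub>F at_right 0))"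

(* Meaningful only at points of differentiability. *)
definition gradient :: "(real ^ 'n \<Rightarrow> real) \<Rightarrow> real ^ 'n \<Rightarrow> real ^ 'n" where
  "gradient f x = (THE D. GDERIV f x :> D)"

definition smoothed_objective ::
  "(real \<Rightarrow> real \<Rightarrow> real) \<Rightarrow> (real ^ 'n \<Rightarrow> 'd \<Rightarrow> real) \<Rightarrow> (nat \<Rightarrow> 'd) \<Rightarrow> nat
     \<Rightarrow> real ^ 'n \<Rightarrow> real \<Rightarrow> real" where
  "smoothed_objective \<Phi> \<psi> \<xi> N x \<mu> = (1 / real N) * (\<Sum>i = 1..N. \<Phi> (\<psi> x (\<xi> i)) \<mu>)"

definition batch_smoothing_gradient ::
  "(real \<Rightarrow> real \<Rightarrow> real) \<Rightarrow> (real ^ 'n \<Rightarrow> 'd \<Rightarrow> real) \<Rightarrow> (nat \<Rightarrow> 'd) \<Rightarrow> nat set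
     \<Rightarrow> real ^ 'n \<Rightarrow> real \<Rightarrow> real ^ 'n" where
  "batch_smoothing_gradient \<Phi> \<psi> \<xi> B x \<mu> =
     (1 / real (card B)) *\<^sub>R
       (\<Sum>i\<in>B. deriv (\<lambda>z. \<Phi> z \<mu>) (\<psi> x (\<xi> i)) *\<^sub>R gradient (\<lambda>y. \<psi> y (\<xi> i)) x)"

(* Uniform sampling of b indices without replacement: all b-element subsets of {1..N} are
   equally likely. The set of these subsets is nonempty exactly when b \<le> N. *)
definition minibatch_pmf :: "nat \<Rightarrow> nat \<Rightarrow> nat set pmf" where
  "minibatch_pmf N b = pmf_of_set {B. B \<subseteq> {1..N} \<and> card B = b}"

end

theory Submission
  imports Defs
begin

text \<open>Both sides equal the full average (1/N) \<Sum> D_i of the per-sample gradients D_i =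
  \<open>deriv (\<lambda>z. \<Phi> z \<mu>) (\<psi> x (\<xi> i)) *\<^sub>R gradient (\<lambda>y.
  \<psi> y (\<xi> i)) x\<close>. For the gradient this is the chain rule and linearity, since \<mu>
  > 0 makes the smoothing function C1 in its first argument
  (\<open>GDERIV_smoothed_objective\<close>). For the expectation it is a symmetry of sampling:
  every index lies in the same number of batches, hence in a random batch with probability b/N, and
  the factor 1/b of the batch mean turns this into the weight 1/N
  (\<open>sum_subsets_of_card\<close>, \<open>expectation_minibatch_mean\<close>).\<close>

lemma sum_subsets_of_card:
  fixes h :: "'a \<Rightarrow> 'b::real_vector"
  assumes "finite A" and "1 \<le> b"
  shows "(\<Sum>B | B \<subseteq> A \<and> card B = b. \<Sum>i\<in>B. h i) =
    real ((card A - 1) choose (b - 1)) *\<^sub>R (\<Sum>i\<in>A. h i)"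
proof -
  have count: "card {B. (B \<subseteq> A \<and> card B = b) \<and> i \<in> B} = (card A - 1) choose (b - 1)"
    if "i \<in> A" for i
  proof -
    \<comment> \<open>A batch through i is determined by its other b - 1 members, chosen from A -
      {i}. The assumption 1 \<le> b keeps the truncated subtraction honest.\<close>
    have "bij_betw (insert i) {B. B \<subseteq> A - {i} \<and> card B = b - 1}
        {B. (B \<subseteq> A \<and> card B = b) \<and> i \<in> B}"
    proof (rule bij_betw_byWitness[where f' = "\<lambda>B. B - {i}"])
      show "insert i ` {B. B \<subseteq> A - {i} \<and> card B = b - 1}
          \<subseteq> {B. (B \<subseteq> A \<and> card B = b) \<and> i \<in> B}"
      proof clarify
        fix B assume B: "B \<subseteq> A - {i}" "card B = b - 1"
        moreover have "finite B" using B assms(1) by (meson finite_Diff finite_subset)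
        moreover have "i \<notin> B" using B(1) by blast
        ultimately show "(insert i B \<subseteq> A \<and> card (insert i B) = b) \<and> i \<in> insert i B"
          using assms(2) \<open>i \<in> A\<close> by auto
      qed
    qed auto
    from bij_betw_same_card[OF this] show ?thesis
      using assms(1) \<open>i \<in> A\<close> by (simp add: n_subsets)
  qed
  \<comment> \<open>Double counting: the inner sum is rewritten over A with the restriction i \<in>
    B, so that the order of summation can be exchanged; h i is then counted once per batch through
    i.\<close>
  have "(\<Sum>B | B \<subseteq> A \<and> card B = b. \<Sum>i\<in>B. h i) =
      (\<Sum>B | B \<subseteq> A \<and> card B = b. \<Sum>i | i \<in> A \<and> i \<in> B. h i)"
    by (intro sum.cong arg_cong2[where f = sum]) auto
  also have "\<dots> = (\<Sum>i\<in>A. \<Sum>B | B \<in> {B. B \<subseteq> A \<and> card B = b} \<and> i \<in> B. h i)"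
    using assms(1) by (intro sum.swap_restrict) auto
  also have "\<dots> = (\<Sum>i\<in>A. real ((card A - 1) choose (b - 1)) *\<^sub>R h i)"
    using count by (intro sum.cong) (auto simp: sum_constant_scaleR)
  finally show ?thesis by (simp add: scaleR_sum_right)
qed

text \<open>The mean of a random batch is unbiased for the population mean because each index has
  inclusion probability b/N. No independence between the sampled indices is involved.\<close>

lemma expectation_minibatch_mean:
  fixes h :: "nat \<Rightarrow> 'b::{banach, second_countable_topology}"
  assumes "1 \<le> b" and "b \<le> N"
  shows "measure_pmf.expectation (minibatch_pmf N b)
      (\<lambda>B. (1 / real (card B)) *\<^sub>R (\<Sum>i\<in>B. h i)) = (1 / real N) *\<^sub>R (\<Sum>i = 1..N. h i)"
proof -
  let ?S = "{B. B \<subseteq> {1..N} \<and> card B = b}"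
  have fin: "finite ?S" by simp
  have card: "card ?S = N choose b" using n_subsets[of "{1..N}" b] by simp
  \<comment> \<open>Here b \<le> N enters: some batch exists, so \<open>pmf_of_set\<close> really is
    the uniform distribution.\<close>
  have pos: "0 < N choose b" using assms(2) by simp
  then have ne: "?S \<noteq> {}" using card by (metis card.empty less_irrefl)
  \<comment> \<open>The absorption identity for binomial coefficients; divided out, it gives the
    inclusion probability b/N.\<close>
  have "real b * real (N choose b) = real N * real ((N - 1) choose (b - 1))"
    using times_binomial_minus1_eq[of b N] assms(1) by (metis of_nat_mult zero_less_one less_le_trans)
  then have ratio: "real ((N - 1) choose (b - 1)) / (real (N choose b) * real b) = 1 / real N"
    using assms pos by (simp add: field_simps)
  have "measure_pmf.expectation (minibatch_pmf N b)
      (\<lambda>B. (1 / real (card B)) *\<^sub>R (\<Sum>i\<in>B. h i)) =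
      (\<Sum>B\<in>?S. (1 / real (N choose b)) *\<^sub>R (1 / real (card B)) *\<^sub>R (\<Sum>i\<in>B. h i))"
    unfolding minibatch_pmf_def
    by (subst integral_measure_pmf[where A = ?S])
      (use fin ne card in \<open>auto simp: set_pmf_of_set intro!: sum.cong\<close>)
  also have "\<dots> = (1 / (real (N choose b) * real b)) *\<^sub>R (\<Sum>B\<in>?S. \<Sum>i\<in>B. h i)"
    unfolding scaleR_sum_right[of _ _ ?S] by (intro sum.cong) auto
  also have "\<dots> = (1 / real N) *\<^sub>R (\<Sum>i = 1..N. h i)"
    using ratio sum_subsets_of_card[of "{1..N}" b h] assms(1) by simp
  finally show ?thesis .
qed

text \<open>The derivative is unique and a vector is determined by its inner products, so the
  description in \<open>gradient\<close> picks out D.\<close>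

lemma gradient_eqI:
  assumes "GDERIV f x :> D"
  shows "gradient f x = D"
  unfolding gradient_def
proof (rule the_equality[where P = "\<lambda>D. GDERIV f x :> D", OF assms])
  fix D' assume "GDERIV f x :> D'"
  then have "(\<lambda>h. h \<bullet> D') = (\<lambda>h. h \<bullet> D)"
    using assms unfolding gderiv_def by (rule has_derivative_unique)
  then show "D' = D" by (metis vector_eq_ldot)
qed

lemma GDERIV_gradient:
  assumes "f differentiable (at x)"
  shows "GDERIV f x :> gradient f x"
proof -
  obtain f' where f': "(f has_derivative f') (at x)"
    using assms unfolding differentiable_def by blast
  \<comment> \<open>Riesz representation: the inner product on the reals is multiplication, so the
    adjoint applied to 1 represents the functional f'.\<close>
  have "f' = (\<lambda>h. h \<bullet> adjoint f' 1)"
    using adjoint_works[OF has_derivative_linear[OF f']] by auto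
  then have "GDERIV f x :> adjoint f' 1" using f' unfolding gderiv_def by metis
  then show ?thesis using gradient_eqI by metis
qed

lemma GDERIV_smoothed_objective:
  assumes "\<And>i. i \<in> {1..N} \<Longrightarrow> (\<lambda>y. \<psi> y (\<xi> i)) differentiable (at x)"
    and "(\<lambda>z. \<Phi> z \<mu>) C1_differentiable_on UNIV"
  shows "GDERIV (\<lambda>y. smoothed_objective \<Phi> \<psi> \<xi> N y \<mu>) x :>
    (1 / real N) *\<^sub>R
      (\<Sum>i = 1..N. deriv (\<lambda>z. \<Phi> z \<mu>) (\<psi> x (\<xi> i)) *\<^sub>R gradient (\<lambda>y. \<psi> y (\<xi> i)) x)"
proof -
  have outer: "DERIV (\<lambda>z. \<Phi> z \<mu>) z :> deriv (\<lambda>z. \<Phi> z \<mu>) z" for z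
    using assms(2) unfolding C1_differentiable_on_eq
    by (auto simp: DERIV_deriv_iff_real_differentiable)
  have "GDERIV (\<lambda>y. \<Phi> (\<psi> y (\<xi> i)) \<mu>) x :>
      deriv (\<lambda>z. \<Phi> z \<mu>) (\<psi> x (\<xi> i)) *\<^sub>R gradient (\<lambda>y. \<psi> y (\<xi> i)) x" if "i \<in> {1..N}" for i
    using GDERIV_DERIV_compose[OF GDERIV_gradient[OF assms(1)[OF that]] outer] .
  \<comment> \<open>Pulling the scalar and the sum out of the inner product puts the derivative in
    the form of a multiple of a sum of derivatives.\<close>
  then show ?thesis
    unfolding gderiv_def smoothed_objective_def inner_scaleR_right inner_sum_right
    by (intro has_derivative_mult_right has_derivative_sum)
qed

theorem proposition5p1:
  fixes N b :: nat
    and \<psi> :: "real ^ 'n \<Rightarrow> 'd \<Rightarrow> real"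
    and \<xi> :: "nat \<Rightarrow> 'd"
    and \<phi> :: "real \<Rightarrow> real"
    and \<Phi> :: "real \<Rightarrow> real \<Rightarrow> real"
  assumes "N \<ge> 1"
    and "1 \<le> b" and "b \<le> N"
    and "\<And>i x. i \<in> {1..N} \<Longrightarrow> (\<lambda>y. \<psi> y (\<xi> i)) differentiable (at x)"
    and "locally_lipschitz \<phi>"
    and "smoothing_function \<Phi> \<phi>"
  shows "\<forall>x. \<forall>\<mu>>0.
      (\<lambda>y. smoothed_objective \<Phi> \<psi> \<xi> N y \<mu>) differentiable (at x) \<and>
      gradient (\<lambda>y. smoothed_objective \<Phi> \<psi> \<xi> N y \<mu>) x =
        measure_pmf.expectation (minibatch_pmf N b)
          (\<lambda>B. batch_smoothing_gradient \<Phi> \<psi> \<xi> B x \<mu>)"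
proof (intro allI impI)
  fix x :: "real ^ 'n" and \<mu> :: real
  assume "\<mu> > 0"
  then have "(\<lambda>z. \<Phi> z \<mu>) C1_differentiable_on UNIV"
    using assms(6) unfolding smoothing_function_def by blast
  \<comment> \<open>Unbiasedness is obtained in \<open>GDERIV\<close> form, with the expectation
    itself as the gradient vector; this yields differentiability and the value of
    \<open>gradient\<close> together.\<close>
  with assms(4) have G: "GDERIV (\<lambda>y. smoothed_objective \<Phi> \<psi> \<xi> N y \<mu>) x :>
      measure_pmf.expectation (minibatch_pmf N b)
        (\<lambda>B. batch_smoothing_gradient \<Phi> \<psi> \<xi> B x \<mu>)"
    unfolding batch_smoothing_gradient_def expectation_minibatch_mean[OF assms(2,3)]
    by (rule GDERIV_smoothed_objective)
  then show "(\<lambda>y. smoothed_objective \<Phi> \<psi> \<xi> N y \<mu>) differentiable (at x) \<and>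
      gradient (\<lambda>y. smoothed_objective \<Phi> \<psi> \<xi> N y \<mu>) x =
        measure_pmf.expectation (minibatch_pmf N b)
          (\<lambda>B. batch_smoothing_gradient \<Phi> \<psi> \<xi> B x \<mu>)"
    unfolding gderiv_def[of _ x] by (auto intro: differentiableI gradient_eqI[OF G])
qed

end
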